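(* Let $N\ge 2$ and $d\ge 1$ be integers and let $\tau>0$. Let the influence function $\psi:[0,\infty)\to[0,\infty)$ be continuous and strictly positive on $[0,\infty)$, with $\psi\le 1$. Consider the delay system $$\dot x_i(t)=\sum_{j\neq i}\psi_{ij}(t)\,\bigl(x_j(t-\tau)-x_i(t)\bigr),\qquad i=1,\dots,N,\ t>0,$$ for $x_i(t)\in\mathbb{R}^d$, with initial datum $x_i(s)=x_i^0(s)$ for $s\in[-\tau,0]$, where $x_i^0\in C([-\tau,0];\mathbb{R}^d)$, $i=1,\dots,N$. Let the communication weights $\psi_{ij}$ be given by any one of the three formulas (A), (B), (C) listed in the context, and verify $$\sum_{j\neq i}\psi_{ij}(t)\le 1\qquad\text{for all } i=1,\dots,N \text{ and } t\ge 0.$$ Then every solution reaches global asymptotic consensus, i.e. $$\lim_{t\to\infty}|x_i(t)-x_j(t)|=0\qquad\text{for all } i,j\in\{1,\dots,N\}.$$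
   Context: The system is the Hegselmann-Krause model with transmission-type delay. Sums $\sum_{j\neq i}$ run over $j\in\{1,\dots,N\}\setminus\{i\}$. The communication weights, for $i \neq j$, are given (the same formula for all $i,j,t$) by one of: (A) $\psi_{ij}(t)=\dfrac{1}{N-1}\,\psi(|x_j(t-\tau)-x_i(t)|)$; (B) $\psi_{ij}(t)=\dfrac{\psi(|x_j(t-\tau)-x_i(t)|)}{\sum_{\ell=1}^N\psi(|x_\ell(t-\tau)-x_i(t)|)}$; (C) $\psi_{ij}(t)=\dfrac{\psi(|x_j(t-\tau)-x_i(t)|)}{\sum_{\ell\neq i}\psi(|x_\ell(t-\tau)-x_i(t)|)}$. A solution is a family of continuous functions $x_i:[-\tau,\infty)\to\mathbb{R}^d$ that coincide with $x_i^0$ on $[-\tau,0]$, are continuously differentiable on $[0,\infty)$ (one-sided derivative at $0$), and satisfy the system. No monotonicity or decay assumption on $\psi$ is made, and $\tau>0$ is arbitrary. *)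

theory Defs
  imports "HOL-Analysis.Analysis"
begin

text \<open>
  The agents are indexed by \<open>{1..N}\<close>; \<open>x i t\<close> is the opinion of agent \<open>i\<close> at time \<open>t\<close>. The
  influence function \<open>\<psi>\<close> is a total function on the reals, but only its values on \<open>{0..}\<close> matter.
  Likewise \<open>x i\<close> is only evaluated on \<open>{- \<tau>..}\<close>, and weights only for distinct agents and
  times \<open>t \<ge> 0\<close>.
\<close>

definition weight_A ::
  "nat \<Rightarrow> real \<Rightarrow> (real \<Rightarrow> real) \<Rightarrow> (nat \<Rightarrow> real \<Rightarrow> real ^ 'd) \<Rightarrow> nat \<Rightarrow> nat \<Rightarrow> real \<Rightarrow> real" where
  "weight_A N \<tau> \<psi> x i j t = 1 / (real N - 1) * \<psi> (norm (x j (t - \<tau>) - x i t))"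

text \<open>In \<open>weight_B\<close> the normalising sum includes the agent \<open>i\<close> itself, with its own delayed
  position; in \<open>weight_C\<close> it does not.\<close>

definition weight_B ::
  "nat \<Rightarrow> real \<Rightarrow> (real \<Rightarrow> real) \<Rightarrow> (nat \<Rightarrow> real \<Rightarrow> real ^ 'd) \<Rightarrow> nat \<Rightarrow> nat \<Rightarrow> real \<Rightarrow> real" where
  "weight_B N \<tau> \<psi> x i j t =
     \<psi> (norm (x j (t - \<tau>) - x i t)) / (\<Sum>l\<in>{1..N}. \<psi> (norm (x l (t - \<tau>) - x i t)))"

definition weight_C ::
  "nat \<Rightarrow> real \<Rightarrow> (real \<Rightarrow> real) \<Rightarrow> (nat \<Rightarrow> real \<Rightarrow> real ^ 'd) \<Rightarrow> nat \<Rightarrow> nat \<Rightarrow> real \<Rightarrow> real" where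
  "weight_C N \<tau> \<psi> x i j t =
     \<psi> (norm (x j (t - \<tau>) - x i t)) / (\<Sum>l\<in>{1..N} - {i}. \<psi> (norm (x l (t - \<tau>) - x i t)))"

text \<open>Continuous differentiability on \<open>[0,\<infinity>)\<close> with the one-sided derivative at \<open>0\<close>. The library's
  \<open>C1_differentiable_on\<close> asks for a two-sided derivative at every point, hence does not fit.\<close>

definition C1_nonneg :: "(real \<Rightarrow> real ^ 'd) \<Rightarrow> bool" where
  "C1_nonneg f \<longleftrightarrow>
     (\<exists>D. continuous_on {0..} D \<and> (\<forall>t\<ge>0. (f has_vector_derivative D t) (at t within {0..})))"

definition HK_solution ::
  "nat \<Rightarrow> real \<Rightarrow> (nat \<Rightarrow> nat \<Rightarrow> real \<Rightarrow> real) \<Rightarrow> (nat \<Rightarrow> real \<Rightarrow> real ^ 'd) \<Rightarrow> (nat \<Rightarrow> real \<Rightarrow> real ^ 'd) \<Rightarrow> bool"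
  where
  "HK_solution N \<tau> w x0 x \<longleftrightarrow>
     (\<forall>i\<in>{1..N}.
        continuous_on {- \<tau>..} (x i) \<and>
        (\<forall>s\<in>{- \<tau>..0}. x i s = x0 i s) \<and>
        C1_nonneg (x i) \<and>
        (\<forall>t>0. (x i has_vector_derivative
                  (\<Sum>j\<in>{1..N} - {i}. w i j t *\<^sub>R (x j (t - \<tau>) - x i t))) (at t)))"

end

theory Submission
  imports Defs
begin

text \<open>
  Everything rests on a scalar linear problem. Fix a solution, regard its communication weights as
  given functions of time, and look at one coordinate: the resulting real functions satisfy
  \<open>y\<^sub>i' = \<Sum>\<^sub>j a\<^sub>i\<^sub>j(t) (y\<^sub>j(t - \<tau>) - y\<^sub>i(t))\<close> with positive weights of total at most \<open>1\<close>. The nonlinearity is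
  only felt through the size of the weights.

  A maximum principle (\<open>upper_bound_invariant\<close>) shows that a bound valid for all agents on a time
  window of length \<open>\<tau>\<close> stays valid for ever. Applied to every coordinate, it makes the solution
  bounded; hence only a compact set of distances occurs, on which the positive continuous function
  \<open>\<psi>\<close> has a positive minimum. So the weights are bounded below by some \<open>\<alpha> > 0\<close>, however fast \<open>\<psi>\<close> may
  decay at infinity.

  With this \<open>\<alpha>\<close>, the range of the opinions contracts (\<open>range_contracts\<close>). If all values
  lie in \<open>[m, M]\<close>, then at a given time \<open>T\<close> any chosen agent is at distance at least \<open>(M - m) / 2\<close>
  from one of the two endpoints, say \<open>M\<close>. Its distance to \<open>M\<close> decays at most like \<open>e\<^sup>-\<^sup>t\<close>, because the
  total weight is at most \<open>1\<close>; and one delay later all other agents feel this distance with weight at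
  least \<open>\<alpha>\<close>. From time \<open>T + 2\<tau>\<close> on, all agents are away from \<open>M\<close> by a fixed fraction of \<open>M - m\<close>
  (\<open>gap_spreads\<close>); the maximum principle makes this permanent. The fraction depends only on
  \<open>\<tau>\<close> and \<open>\<alpha>\<close>, so iteration drives the range to \<open>0\<close>, for every size of the delay.
\<close>

section \<open>A differential inequality\<close>

text \<open>The function \<open>e\<^sup>t (z(t) - \<beta>)\<close> is nondecreasing.\<close>

lemma exponential_lower_bound:
  fixes z :: "real \<Rightarrow> real"
  assumes "s \<le> t"
    and cont: "continuous_on {s..t} z"
    and der: "\<And>u. s < u \<Longrightarrow> u < t \<Longrightarrow> (z has_real_derivative D u) (at u)"
    and ge: "\<And>u. s < u \<Longrightarrow> u < t \<Longrightarrow> \<beta> - z u \<le> D u"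
  shows "exp (s - t) * (z s - \<beta>) \<le> z t - \<beta>"
proof -
  let ?g = "\<lambda>u. exp u * (z u - \<beta>)"
  have "?g s \<le> ?g t"
  proof (rule DERIV_nonneg_imp_increasing_open[OF \<open>s \<le> t\<close>])
    fix u assume u: "s < u" "u < t"
    have "(?g has_real_derivative exp u * (z u - \<beta>) + exp u * D u) (at u)"
      by (auto intro!: derivative_eq_intros der[OF u])
    moreover have "0 \<le> exp u * (z u - \<beta>) + exp u * D u"
      using ge[OF u] by (simp flip: distrib_left)
    ultimately show "\<exists>d. (?g has_real_derivative d) (at u) \<and> 0 \<le> d"
      by blast
  next
    show "continuous_on {s..t} ?g"
      by (intro continuous_intros cont)
  qed
  then show ?thesis
    by (simp add: exp_diff field_simps)
qed

section \<open>Scalar delayed averaging\<close>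

text \<open>The weights are merely positive here; a uniform lower bound \<open>\<alpha>\<close> is a hypothesis of the later
  lemmas only. For the Hegselmann--Krause weights such a bound comes from the boundedness of the
  solution, which therefore has to be derived first, from positivity.\<close>

locale delayed_averaging =
  fixes I :: "'i set" and \<tau> :: real
    and a :: "'i \<Rightarrow> 'i \<Rightarrow> real \<Rightarrow> real" and y :: "'i \<Rightarrow> real \<Rightarrow> real"
  assumes fin: "finite I"
    and two_agents: "2 \<le> card I"
    and delay_pos: "0 < \<tau>"
    and weight_pos: "\<And>i j t. i \<in> I \<Longrightarrow> j \<in> I - {i} \<Longrightarrow> 0 < t \<Longrightarrow> 0 < a i j t"
    and weight_sum: "\<And>i t. i \<in> I \<Longrightarrow> 0 < t \<Longrightarrow> (\<Sum>j\<in>I - {i}. a i j t) \<le> 1"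
    and cont: "\<And>i. i \<in> I \<Longrightarrow> continuous_on {- \<tau>..} (y i)"
    and ode: "\<And>i t. i \<in> I \<Longrightarrow> 0 < t \<Longrightarrow>
      (y i has_real_derivative (\<Sum>j\<in>I - {i}. a i j t * (y j (t - \<tau>) - y i t))) (at t)"
begin

text \<open>Statements about lower bounds follow from those about upper bounds by this symmetry.\<close>

lemma negated: "delayed_averaging I \<tau> a (\<lambda>i t. - y i t)"
proof
  fix i t assume i: "i \<in> I" and t: "0 < (t::real)"
  have "(\<Sum>j\<in>I - {i}. a i j t * (- y j (t - \<tau>) - - y i t))
      = - (\<Sum>j\<in>I - {i}. a i j t * (y j (t - \<tau>) - y i t))"
    unfolding sum_negf[symmetric] by (intro sum.cong) (auto simp: algebra_simps)
  then show "((\<lambda>t. - y i t) has_real_derivative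
      (\<Sum>j\<in>I - {i}. a i j t * (- y j (t - \<tau>) - - y i t))) (at t)"
    using DERIV_minus[OF ode[OF i t]] by simp
qed (use fin two_agents delay_pos weight_pos weight_sum cont in \<open>auto intro: continuous_on_minus\<close>)

lemma other_agent:
  assumes "i \<in> I" obtains j where "j \<in> I - {i}"
proof -
  have "card (I - {i}) \<noteq> 0"
    using two_agents assms by simp
  then have "I - {i} \<noteq> {}"
    by (metis card.empty)
  then show ?thesis
    using that by blast
qed

text \<open>One step of length \<open>\<tau>\<close>. If some \<open>y\<^sub>i\<close> exceeded \<open>M\<close>, then at its maximum over the step, where it is
  above all delayed values, it would be strictly decreasing.\<close>

lemma upper_bound_step:
  assumes "0 \<le> S"
    and window: "\<And>j u. j \<in> I \<Longrightarrow> S - \<tau> \<le> u \<Longrightarrow> u \<le> S \<Longrightarrow> y j u \<le> M"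
    and i: "i \<in> I" and t: "S \<le> t" "t \<le> S + \<tau>"
  shows "y i t \<le> M"
proof (rule ccontr)
  assume "\<not> y i t \<le> M"
  then have above: "M < y i t"
    by simp
  have "continuous_on {S..t} (y i)"
    using cont[OF i] by (rule continuous_on_subset) (use \<open>0 \<le> S\<close> delay_pos in auto)
  moreover have "compact {S..t}" "{S..t} \<noteq> {}"
    using t by auto
  ultimately obtain p where p: "p \<in> {S..t}" and max: "\<And>u. u \<in> {S..t} \<Longrightarrow> y i u \<le> y i p"
    using continuous_attains_sup by metis
  have big: "M < y i p"
    using above max[of t] t by auto
  have "y i S \<le> M"
    using window i delay_pos by auto
  then have "S < p"
    using big p by (cases "p = S") auto
  then have "0 < p"
    using \<open>0 \<le> S\<close> by simp
  obtain k where k: "k \<in> I - {i}"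
    using other_agent i by blast
  have neg: "a i j p * (y j (p - \<tau>) - y i p) < 0" if j: "j \<in> I - {i}" for j
  proof -
    have "y j (p - \<tau>) \<le> M"
      using window j p t by auto
    then show ?thesis
      using weight_pos[OF i j \<open>0 < p\<close>] big by (simp add: mult_less_0_iff)
  qed
  have "(\<Sum>j\<in>I - {i}. a i j p * (y j (p - \<tau>) - y i p)) < (\<Sum>j\<in>I - {i}. 0)"
    using fin k neg by (intro sum_strict_mono) auto
  then obtain d where d: "0 < d" "\<And>h. 0 < h \<Longrightarrow> h < d \<Longrightarrow> y i p < y i (p - h)"
    using DERIV_neg_dec_left[OF ode[OF i \<open>0 < p\<close>]] by auto
  define h where "h = min (d / 2) (p - S)"
  have "y i p < y i (p - h)"
    using d \<open>S < p\<close> by (auto simp: h_def min_def)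
  moreover have "p - h \<in> {S..t}"
    using d p \<open>S < p\<close> by (auto simp: h_def min_def)
  ultimately show False
    using max by fastforce
qed

lemma upper_bound_invariant:
  assumes "0 \<le> S"
    and window: "\<And>j u. j \<in> I \<Longrightarrow> S - \<tau> \<le> u \<Longrightarrow> u \<le> S \<Longrightarrow> y j u \<le> M"
    and i: "i \<in> I" and t: "S - \<tau> \<le> t"
  shows "y i t \<le> M"
proof -
  have steps: "y j u \<le> M" if "j \<in> I" "S - \<tau> \<le> u" "u \<le> S + real n * \<tau>" for n j u
    using that
  proof (induction n arbitrary: j u)
    case 0
    then show ?case using window by simp
  next
    case (Suc n)
    show ?case
    proof (cases "u \<le> S + real n * \<tau>")
      case True
      then show ?thesis using Suc by blast
    next
      case False
      have "0 \<le> real n * \<tau>"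
        using delay_pos by simp
      then have "y l v \<le> M" if "l \<in> I" "S + real n * \<tau> - \<tau> \<le> v" "v \<le> S + real n * \<tau>" for l v
        using Suc.IH[of l v] that \<open>0 \<le> real n * \<tau>\<close> by simp
      moreover have "u \<le> S + real n * \<tau> + \<tau>"
        using Suc.prems by (simp add: algebra_simps)
      ultimately show ?thesis
        using upper_bound_step[of "S + real n * \<tau>" M j u] Suc.prems False \<open>0 \<le> S\<close> \<open>0 \<le> real n * \<tau>\<close>
        by simp
    qed
  qed
  obtain n :: nat where "(t - S) / \<tau> \<le> real n"
    using real_arch_simple by blast
  then have "t \<le> S + real n * \<tau>"
    using delay_pos by (simp add: field_simps)
  then show ?thesis
    using steps i t by blast
qed

lemma lower_bound_invariant:
  assumes "0 \<le> S"
    and "\<And>j u. j \<in> I \<Longrightarrow> S - \<tau> \<le> u \<Longrightarrow> u \<le> S \<Longrightarrow> m \<le> y j u"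
    and "i \<in> I" and "S - \<tau> \<le> t"
  shows "m \<le> y i t"
  using delayed_averaging.upper_bound_invariant[OF negated, of S "- m" i t] assms by simp

lemma bounded_for_all_times:
  obtains B where "\<And>i t. i \<in> I \<Longrightarrow> - \<tau> \<le> t \<Longrightarrow> \<bar>y i t\<bar> \<le> B"
proof -
  have "bounded (y i ` {- \<tau>..0})" if "i \<in> I" for i
    using cont[OF that]
    by (intro compact_imp_bounded compact_continuous_image continuous_on_subset[OF cont[OF that]]) auto
  then have "bounded (\<Union>i\<in>I. y i ` {- \<tau>..0})"
    using fin by (intro bounded_UN) auto
  then obtain B where "\<forall>z\<in>(\<Union>i\<in>I. y i ` {- \<tau>..0}). \<bar>z\<bar> \<le> B"
    by (auto simp: bounded_real)
  then have B: "\<bar>y i t\<bar> \<le> B" if "i \<in> I" "- \<tau> \<le> t" "t \<le> 0" for i t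
    using that by auto
  have "\<bar>y i t\<bar> \<le> B" if "i \<in> I" "- \<tau> \<le> t" for i t
    using upper_bound_invariant[of 0 B i t] lower_bound_invariant[of 0 "- B" i t] B that
    by (simp add: abs_le_iff minus_le_iff)
  then show ?thesis
    using that by blast
qed

text \<open>The derivative of the gap \<open>M - y\<^sub>i\<close> is \<open>\<Sum>\<^sub>j a\<^sub>i\<^sub>j (M - y\<^sub>j(t - \<tau>)) - (\<Sum>\<^sub>j a\<^sub>i\<^sub>j) (M - y\<^sub>i)\<close>. In the first sum all
  terms are nonnegative, and one of them is kept; the total weight in the second is at most \<open>1\<close>.\<close>

lemma gap_derivative_ge:
  assumes i: "i \<in> I" and k: "k \<in> I - {i}" and t: "0 < t"
    and below: "\<And>j. j \<in> I \<Longrightarrow> y j (t - \<tau>) \<le> M" "y i t \<le> M"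
  shows "a i k t * (M - y k (t - \<tau>)) - (M - y i t)
    \<le> - (\<Sum>j\<in>I - {i}. a i j t * (y j (t - \<tau>) - y i t))"
proof -
  have "a i k t * (M - y k (t - \<tau>)) \<le> (\<Sum>j\<in>I - {i}. a i j t * (M - y j (t - \<tau>)))"
    using fin k below weight_pos[OF i _ t]
    by (intro member_le_sum) (auto intro!: mult_nonneg_nonneg intro: less_imp_le)
  moreover have "(\<Sum>j\<in>I - {i}. a i j t) * (M - y i t) \<le> M - y i t"
    using weight_sum[OF i t] below weight_pos[OF i _ t]
    by (intro mult_left_le_one_le sum_nonneg) (auto intro: less_imp_le)
  moreover have "(\<Sum>j\<in>I - {i}. a i j t * (M - y j (t - \<tau>))) - (\<Sum>j\<in>I - {i}. a i j t) * (M - y i t)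
      = - (\<Sum>j\<in>I - {i}. a i j t * (y j (t - \<tau>) - y i t))"
    unfolding sum_distrib_right sum_subtractf[symmetric] sum_negf[symmetric]
    by (intro sum.cong) (auto simp: algebra_simps)
  ultimately show ?thesis
    by linarith
qed

text \<open>During \<open>[T, T + 3\<tau>]\<close> the gap of agent \<open>k\<close> is at least \<open>e\<^sup>-\<^sup>3\<^sup>\<tau> \<delta>\<close>. From time \<open>T + \<tau>\<close> on, the other
  agents see it through the delay, and one further period \<open>\<tau>\<close> raises their gaps to the stated size.
  This covers the whole window \<open>[T + 2\<tau>, T + 3\<tau>]\<close>, so the maximum principle takes over.\<close>

lemma gap_spreads:
  assumes "0 \<le> T" and "0 \<le> \<delta>" and "0 < \<alpha>"
    and weight_ge: "\<And>i j t. i \<in> I \<Longrightarrow> j \<in> I - {i} \<Longrightarrow> 0 < t \<Longrightarrow> \<alpha> \<le> a i j t"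
    and below: "\<And>i t. i \<in> I \<Longrightarrow> T - \<tau> \<le> t \<Longrightarrow> y i t \<le> M"
    and k: "k \<in> I" and gap: "\<delta> \<le> M - y k T"
    and i: "i \<in> I" and t: "T + 2 * \<tau> \<le> t"
  shows "y i t \<le> M - \<alpha> * exp (- 3 * \<tau>) * (1 - exp (- \<tau>)) * \<delta>"
proof -
  let ?D = "\<lambda>i t. - (\<Sum>j\<in>I - {i}. a i j t * (y j (t - \<tau>) - y i t))"
  have gap_cont: "continuous_on {u..v} (\<lambda>t. M - y j t)" if "j \<in> I" "0 \<le> u" for j u v
    using that delay_pos by (intro continuous_intros continuous_on_subset[OF cont]) auto
  have gap_deriv: "((\<lambda>t. M - y j t) has_real_derivative ?D j u) (at u)" if "j \<in> I" "0 < u" for j u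
    using DERIV_diff[OF DERIV_const[of M] ode[OF that]] by simp
  have gap_k: "exp (- 3 * \<tau>) * \<delta> \<le> M - y k u" if u: "T \<le> u" "u \<le> T + 3 * \<tau>" for u
  proof -
    obtain l where l: "l \<in> I - {k}"
      using other_agent k by blast
    have "exp (T - u) * ((M - y k T) - 0) \<le> (M - y k u) - 0"
    proof (rule exponential_lower_bound[OF u(1), where D = "?D k"])
      fix v assume v: "T < v" "v < u"
      have "0 \<le> a k l v * (M - y l (v - \<tau>))"
        using weight_pos[OF k l, of v] below[of l "v - \<tau>"] l v \<open>0 \<le> T\<close> by simp
      then show "0 - (M - y k v) \<le> ?D k v"
        using gap_derivative_ge[OF k l, of v M] below k v \<open>0 \<le> T\<close> delay_pos by fastforce
    qed (use gap_cont gap_deriv k \<open>0 \<le> T\<close> in auto)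
    moreover have "exp (- 3 * \<tau>) * \<delta> \<le> exp (T - u) * (M - y k T)"
      using u gap \<open>0 \<le> \<delta>\<close> by (intro mult_mono) auto
    ultimately show ?thesis
      by simp
  qed
  define \<beta> where "\<beta> = \<alpha> * (exp (- 3 * \<tau>) * \<delta>)"
  have \<beta>: "0 \<le> \<beta>"
    using \<open>0 < \<alpha>\<close> \<open>0 \<le> \<delta>\<close> by (simp add: \<beta>_def)
  have window: "(1 - exp (- \<tau>)) * \<beta> \<le> M - y j u"
    if j: "j \<in> I" and u: "T + 2 * \<tau> \<le> u" "u \<le> T + 3 * \<tau>" for j u
  proof (cases "j = k")
    case True
    obtain l where l: "l \<in> I - {k}"
      using other_agent k by blast
    have "\<alpha> \<le> (\<Sum>j\<in>I - {k}. a k j 1)"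
      using weight_ge[OF k l, of 1] fin l weight_pos[OF k, of _ 1]
      by (intro order_trans[OF _ member_le_sum[of l]]) (auto intro: less_imp_le)
    then have "\<alpha> \<le> 1"
      using weight_sum[OF k, of 1] by simp
    then have "\<beta> \<le> exp (- 3 * \<tau>) * \<delta>"
      unfolding \<beta>_def using \<open>0 < \<alpha>\<close> \<open>0 \<le> \<delta>\<close> by (intro mult_left_le_one_le) auto
    moreover have "(1 - exp (- \<tau>)) * \<beta> \<le> \<beta>"
      using \<beta> delay_pos by (intro mult_left_le_one_le) auto
    moreover have "exp (- 3 * \<tau>) * \<delta> \<le> M - y j u"
      using gap_k[of u] u True delay_pos by simp
    ultimately show ?thesis
      by linarith
  next
    case False
    then have kj: "k \<in> I - {j}"
      using k by simp
    have "exp (T + \<tau> - u) * ((M - y j (T + \<tau>)) - \<beta>) \<le> (M - y j u) - \<beta>"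
    proof (rule exponential_lower_bound[where D = "?D j"])
      fix v assume v: "T + \<tau> < v" "v < u"
      have "\<beta> \<le> a j k v * (M - y k (v - \<tau>))"
        unfolding \<beta>_def
        using weight_ge[OF j kj, of v] gap_k[of "v - \<tau>"] v u delay_pos \<open>0 < \<alpha>\<close> \<open>0 \<le> \<delta>\<close> \<open>0 \<le> T\<close>
        by (intro mult_mono) auto
      then show "\<beta> - (M - y j v) \<le> ?D j v"
        using gap_derivative_ge[OF j kj, of v M] below j v \<open>0 \<le> T\<close> delay_pos by fastforce
    qed (use gap_cont gap_deriv j u \<open>0 \<le> T\<close> delay_pos in auto)
    moreover have "exp (T + \<tau> - u) * (- \<beta>) \<le> exp (T + \<tau> - u) * ((M - y j (T + \<tau>)) - \<beta>)"
      using below[OF j, of "T + \<tau>"] delay_pos by (intro mult_left_mono) auto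
    moreover have "exp (T + \<tau> - u) * \<beta> \<le> exp (- \<tau>) * \<beta>"
      using u \<beta> by (intro mult_right_mono) auto
    ultimately show ?thesis
      by (simp add: left_diff_distrib)
  qed
  have "y i t \<le> M - (1 - exp (- \<tau>)) * \<beta>"
  proof (rule upper_bound_invariant[of "T + 3 * \<tau>" _ i t])
    fix j u assume "j \<in> I" "T + 3 * \<tau> - \<tau> \<le> u" "u \<le> T + 3 * \<tau>"
    then show "y j u \<le> M - (1 - exp (- \<tau>)) * \<beta>"
      using window[of j u] by simp
  qed (use i t \<open>0 \<le> T\<close> delay_pos in auto)
  then show ?thesis
    by (simp add: \<beta>_def algebra_simps)
qed

text \<open>Agent \<open>k\<close> is in one of the two halves of \<open>[m, M]\<close> at time \<open>T\<close>. The case of the upper half is that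
  of the lower half for the reflected system \<open>- y\<close>.\<close>

lemma range_contracts:
  assumes "0 \<le> T" and "0 < \<alpha>"
    and weight_ge: "\<And>i j t. i \<in> I \<Longrightarrow> j \<in> I - {i} \<Longrightarrow> 0 < t \<Longrightarrow> \<alpha> \<le> a i j t"
    and bounds: "\<And>i t. i \<in> I \<Longrightarrow> T - \<tau> \<le> t \<Longrightarrow> m \<le> y i t \<and> y i t \<le> M"
    and \<kappa>: "\<kappa> = \<alpha> * exp (- 3 * \<tau>) * (1 - exp (- \<tau>))"
  obtains m' M' where "M' - m' = (1 - \<kappa> / 2) * (M - m)"
    and "\<forall>i\<in>I. \<forall>t\<ge>T + 2 * \<tau>. m' \<le> y i t \<and> y i t \<le> M'"
proof -
  obtain k where k: "k \<in> I"
    using two_agents by fastforce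
  have mM: "0 \<le> (M - m) / 2"
    using bounds[OF k, of T] delay_pos by simp
  consider "(M - m) / 2 \<le> M - y k T" | "(M - m) / 2 \<le> (- m) - (- y k T)"
    by (smt (verit) field_sum_of_halves)
  then show ?thesis
  proof cases
    case 1
    have "y i t \<le> M - \<kappa> * ((M - m) / 2)" if "i \<in> I" "T + 2 * \<tau> \<le> t" for i t
      unfolding \<kappa>
      using gap_spreads[OF \<open>0 \<le> T\<close> mM \<open>0 < \<alpha>\<close> weight_ge _ k 1 that] bounds by blast
    then show ?thesis
      using bounds delay_pos by (intro that[of "M - \<kappa> * ((M - m) / 2)" m]) (auto simp: algebra_simps)
  next
    case 2
    have "- y i t \<le> - m - \<kappa> * ((M - m) / 2)" if "i \<in> I" "T + 2 * \<tau> \<le> t" for i t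
      unfolding \<kappa>
      using delayed_averaging.gap_spreads[OF negated \<open>0 \<le> T\<close> mM \<open>0 < \<alpha>\<close> weight_ge _ k 2 that] bounds
      by simp
    then have "m + \<kappa> * ((M - m) / 2) \<le> y i t" if "i \<in> I" "T + 2 * \<tau> \<le> t" for i t
      using that by fastforce
    then show ?thesis
      using bounds delay_pos by (intro that[of M "m + \<kappa> * ((M - m) / 2)"]) (auto simp: algebra_simps)
  qed
qed

lemma consensus:
  assumes "0 < \<alpha>"
    and weight_ge: "\<And>i j t. i \<in> I \<Longrightarrow> j \<in> I - {i} \<Longrightarrow> 0 < t \<Longrightarrow> \<alpha> \<le> a i j t"
    and i: "i \<in> I" and j: "j \<in> I"
  shows "((\<lambda>t. y i t - y j t) \<longlongrightarrow> 0) at_top"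
proof -
  obtain B where B: "\<And>i t. i \<in> I \<Longrightarrow> - \<tau> \<le> t \<Longrightarrow> \<bar>y i t\<bar> \<le> B"
    using bounded_for_all_times by blast
  define \<kappa> where "\<kappa> = \<alpha> * exp (- 3 * \<tau>) * (1 - exp (- \<tau>))"
  \<comment> \<open>Truncation at \<open>0\<close> spares a proof that \<open>\<kappa> \<le> 2\<close>.\<close>
  define q where "q = max 0 (1 - \<kappa> / 2)"
  have "0 < \<kappa>"
    using \<open>0 < \<alpha>\<close> delay_pos by (simp add: \<kappa>_def)
  then have q: "0 \<le> q" "q < 1" "1 - \<kappa> / 2 \<le> q"
    by (auto simp: q_def)
  have iterate: "\<exists>T m M. 0 \<le> T \<and> M - m \<le> q ^ n * (2 * B) \<and>
      (\<forall>i\<in>I. \<forall>t\<ge>T - \<tau>. m \<le> y i t \<and> y i t \<le> M)" for n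
  proof (induction n)
    case 0
    have "- B \<le> y i t \<and> y i t \<le> B" if "i \<in> I" "0 - \<tau> \<le> t" for i t
      using B[of i t] that by (simp add: abs_le_iff)
    then show ?case
      by (intro exI[of _ 0] exI[of _ "- B"] exI[of _ B]) auto
  next
    case (Suc n)
    then obtain T m M where T: "0 \<le> T" and mM: "M - m \<le> q ^ n * (2 * B)"
      and bounds: "\<And>i t. i \<in> I \<Longrightarrow> T - \<tau> \<le> t \<Longrightarrow> m \<le> y i t \<and> y i t \<le> M"
      by blast
    obtain m' M' where M': "M' - m' = (1 - \<kappa> / 2) * (M - m)"
      and bounds': "\<forall>i\<in>I. \<forall>t\<ge>T + 2 * \<tau>. m' \<le> y i t \<and> y i t \<le> M'"
      by (rule range_contracts[OF T \<open>0 < \<alpha>\<close> weight_ge bounds \<kappa>_def])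
    have "0 \<le> M - m"
      using bounds[OF i, of T] delay_pos by simp
    then have "M' - m' \<le> q * (M - m)"
      unfolding M' using q by (intro mult_right_mono) auto
    also have "\<dots> \<le> q * (q ^ n * (2 * B))"
      using mM q by (intro mult_left_mono) auto
    finally have "M' - m' \<le> q ^ Suc n * (2 * B)"
      by simp
    moreover have "\<forall>i\<in>I. \<forall>t\<ge>(T + 3 * \<tau>) - \<tau>. m' \<le> y i t \<and> y i t \<le> M'"
      using bounds' by simp
    moreover have "0 \<le> T + 3 * \<tau>"
      using T delay_pos by simp
    ultimately show ?case
      by blast
  qed
  have powers: "(\<lambda>n. q ^ n * (2 * B)) \<longlonglongrightarrow> 0"
    using q by (intro tendsto_mult_left_zero LIMSEQ_realpow_zero) auto
  show ?thesis
  proof (rule tendstoI)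
    fix e :: real assume "0 < e"
    then obtain n where n: "q ^ n * (2 * B) < e"
      using order_tendstoD(2)[OF powers] by (metis eventually_sequentially order_refl)
    obtain T m M where mM: "M - m \<le> q ^ n * (2 * B)"
      and bounds: "\<And>i t. i \<in> I \<Longrightarrow> T - \<tau> \<le> t \<Longrightarrow> m \<le> y i t \<and> y i t \<le> M"
      using iterate[of n] by blast
    have "dist (y i t - y j t) 0 < e" if "T - \<tau> \<le> t" for t
      using bounds[OF i that] bounds[OF j that] mM n by (auto simp: abs_less_iff)
    then show "\<forall>\<^sub>F t in at_top. dist (y i t - y j t) 0 < e"
      unfolding eventually_at_top_linorder by blast
  qed
qed

end

section \<open>The Hegselmann--Krause weights\<close>

text \<open>A common lower bound for the three kinds of weights: since \<open>\<psi> \<le> 1\<close>, each normalising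
  denominator is at most \<open>N\<close>.\<close>

lemma HK_weight_ge:
  fixes x :: "nat \<Rightarrow> real \<Rightarrow> real ^ 'd"
  assumes "2 \<le> N"
    and pos: "\<And>r. 0 \<le> r \<Longrightarrow> 0 < \<psi> r" and le_one: "\<And>r. 0 \<le> r \<Longrightarrow> \<psi> r \<le> 1"
    and w: "w = weight_A N \<tau> \<psi> x \<or> w = weight_B N \<tau> \<psi> x \<or> w = weight_C N \<tau> \<psi> x"
    and j: "j \<in> {1..N} - {i}"
  shows "\<psi> (norm (x j (t - \<tau>) - x i t)) / real N \<le> w i j t"
proof -
  let ?f = "\<lambda>l. \<psi> (norm (x l (t - \<tau>) - x i t))"
  have f: "0 < ?f l" "?f l \<le> 1" for l
    using pos le_one by auto
  have denominator: "0 < sum ?f L \<and> sum ?f L \<le> real N" if "j \<in> L" "L \<subseteq> {1..N}" for L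
  proof
    have "finite L"
      using that(2) finite_subset by blast
    then show "0 < sum ?f L"
      using f that(1) by (intro sum_pos) auto
    have "sum ?f L \<le> real (card L)"
      using f sum_bounded_above[of L ?f 1] by simp
    also have "\<dots> \<le> real N"
      using card_mono[OF _ that(2)] by simp
    finally show "sum ?f L \<le> real N" .
  qed
  have quotient: "?f j / real N \<le> ?f j / D" if "0 < D \<and> D \<le> real N" for D
    using f[of j] that by (intro divide_left_mono) auto
  show ?thesis
    using w
  proof (elim disjE)
    assume "w = weight_A N \<tau> \<psi> x"
    then show ?thesis
      using quotient[of "real N - 1"] \<open>2 \<le> N\<close> by (simp add: weight_A_def)
  next
    assume "w = weight_B N \<tau> \<psi> x"
    then show ?thesis
      using quotient[OF denominator[of "{1..N}"]] j by (simp add: weight_B_def)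
  next
    assume "w = weight_C N \<tau> \<psi> x"
    then show ?thesis
      using quotient[OF denominator[of "{1..N} - {i}"]] j by (simp add: weight_C_def)
  qed
qed

lemma HK_coordinate:
  fixes x :: "nat \<Rightarrow> real \<Rightarrow> real ^ 'd"
  assumes "2 \<le> N" and "0 < \<tau>"
    and "\<And>i j t. i \<in> {1..N} \<Longrightarrow> j \<in> {1..N} - {i} \<Longrightarrow> 0 < t \<Longrightarrow> 0 < w i j t"
    and "\<And>i t. i \<in> {1..N} \<Longrightarrow> 0 < t \<Longrightarrow> (\<Sum>j\<in>{1..N} - {i}. w i j t) \<le> 1"
    and sol: "HK_solution N \<tau> w x0 x"
  shows "delayed_averaging {1..N} \<tau> w (\<lambda>i t. x i t $ c)"
proof
  fix i t assume i: "i \<in> {1..N}" and t: "0 < (t::real)"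
  have "(x i has_vector_derivative (\<Sum>j\<in>{1..N} - {i}. w i j t *\<^sub>R (x j (t - \<tau>) - x i t))) (at t)"
    using sol i t by (simp add: HK_solution_def)
  from bounded_linear.has_vector_derivative[OF bounded_linear_vec_nth this, of c]
  show "((\<lambda>t. x i t $ c) has_real_derivative
      (\<Sum>j\<in>{1..N} - {i}. w i j t * (x j (t - \<tau>) $ c - x i t $ c))) (at t)"
    by (simp add: has_real_derivative_iff_has_vector_derivative)
next
  fix i assume "i \<in> {1..N}"
  then show "continuous_on {- \<tau>..} (\<lambda>t. x i t $ c)"
    using sol by (auto simp: HK_solution_def intro!: continuous_intros)
qed (use assms in auto)

theorem theorem1:
  fixes N :: nat and \<tau> :: real and \<psi> :: "real \<Rightarrow> real"
    and w :: "nat \<Rightarrow> nat \<Rightarrow> real \<Rightarrow> real"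
    and x0 x :: "nat \<Rightarrow> real \<Rightarrow> real ^ 'd"
  assumes "N \<ge> 2"
    and "\<tau> > 0"
    and "continuous_on {0..} \<psi>"
    and "\<And>r. r \<ge> 0 \<Longrightarrow> 0 < \<psi> r"
    and "\<And>r. r \<ge> 0 \<Longrightarrow> \<psi> r \<le> 1"
    and "\<And>i. i \<in> {1..N} \<Longrightarrow> continuous_on {- \<tau>..0} (x0 i)"
    and "w = weight_A N \<tau> \<psi> x \<or> w = weight_B N \<tau> \<psi> x \<or> w = weight_C N \<tau> \<psi> x"
    and "\<And>i t. i \<in> {1..N} \<Longrightarrow> t \<ge> 0 \<Longrightarrow> (\<Sum>j\<in>{1..N} - {i}. w i j t) \<le> 1"
    and "HK_solution N \<tau> w x0 x"
  shows "\<forall>i\<in>{1..N}. \<forall>j\<in>{1..N}. ((\<lambda>t. norm (x i t - x j t)) \<longlongrightarrow> 0) at_top"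
proof -
  let ?I = "{1..N}"
  have w_ge: "\<psi> (norm (x j (t - \<tau>) - x i t)) / real N \<le> w i j t" if "j \<in> ?I - {i}" for i j t
    using HK_weight_ge[OF assms(1,4,5,7) that] .
  have "0 < \<psi> (norm (x j (t - \<tau>) - x i t)) / real N" for i j t
    using assms(1,4) by simp
  then have w_pos: "0 < w i j t" if "j \<in> ?I - {i}" for i j t
    using w_ge[OF that] less_le_trans by blast
  have coordinate: "delayed_averaging ?I \<tau> w (\<lambda>i t. x i t $ c)" for c
    using assms(1,2,8,9) w_pos by (intro HK_coordinate) auto

  have "\<exists>B. \<forall>i\<in>?I. \<forall>t\<ge>- \<tau>. \<bar>x i t $ c\<bar> \<le> B" for c
    using delayed_averaging.bounded_for_all_times[OF coordinate] by metis
  then obtain B where B: "\<And>c i t. i \<in> ?I \<Longrightarrow> - \<tau> \<le> t \<Longrightarrow> \<bar>x i t $ c\<bar> \<le> B c"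
    by metis
  have norm_le: "norm (x i t) \<le> sum B UNIV" if "i \<in> ?I" "- \<tau> \<le> t" for i t
    using norm_le_l1_cart[of "x i t"] sum_mono[of UNIV "\<lambda>c. \<bar>x i t $ c\<bar>" B] B[OF that] by simp
  define R where "R = 2 * sum B UNIV"
  have dist_le: "norm (x j (t - \<tau>) - x i t) \<le> R" if "i \<in> ?I" "j \<in> ?I" "0 < t" for i j t
    using norm_triangle_ineq4[of "x j (t - \<tau>)" "x i t"] norm_le[of j "t - \<tau>"] norm_le[of i t]
      that assms(2) by (simp add: R_def)
  have "0 \<le> R"
    using order_trans[OF norm_ge_zero norm_le[of 1 0]] assms(1,2) by (simp add: R_def)
  then obtain p where p: "p \<in> {0..R}" and min: "\<And>r. r \<in> {0..R} \<Longrightarrow> \<psi> p \<le> \<psi> r"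
    using continuous_attains_inf[of "{0..R}" \<psi>] continuous_on_subset[OF assms(3), of "{0..R}"] by auto
  have "0 < \<psi> p / real N"
    using p assms(1,4) by simp
  have uniform: "\<psi> p / real N \<le> w i j t" if "i \<in> ?I" "j \<in> ?I - {i}" "0 < t" for i j t
  proof -
    have "\<psi> p \<le> \<psi> (norm (x j (t - \<tau>) - x i t))"
      using min dist_le[of i j t] that by simp
    then show ?thesis
      using w_ge[OF that(2), of t] by (meson divide_right_mono of_nat_0_le_iff order_trans)
  qed

  show ?thesis
  proof (intro ballI)
    fix i j assume ij: "i \<in> ?I" "j \<in> ?I"
    have "((\<lambda>t. x i t $ c - x j t $ c) \<longlongrightarrow> 0) at_top" for c
      using delayed_averaging.consensus[OF coordinate \<open>0 < \<psi> p / real N\<close> uniform ij] .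
    then have "((\<lambda>t. x i t - x j t) \<longlongrightarrow> 0) at_top"
      by (intro vec_tendstoI) simp
    then show "((\<lambda>t. norm (x i t - x j t)) \<longlongrightarrow> 0) at_top"
      by (rule tendsto_norm_zero)
  qed
qed

end
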